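(* Let $n\ge 2$ be an integer and let $m\ge 2$ be an even number. Let $\mathcal{A}$ be an $m$th-order $n$-dimensional strong Hankel tensor. Then $\mathcal{A}$ is an SOS tensor and a PSD tensor.
   Context: Write $[n]=\{1,\dots,n\}$. $\mathrm{S}_{m,n}$ is the space of real symmetric tensors $\mathcal{A}=(a_{i_1\cdots i_m})$, $i_j\in[n]$, of order $m$ and dimension $n$. For $\mathcal{A}\in\mathrm{S}_{m,n}$ and $\mathbf{x}\in\mathbb{R}^n$ put $\mathcal{A}\mathbf{x}^{\otimes m}=\sum_{i_1,\dots,i_m\in[n]}a_{i_1\cdots i_m}x_{i_1}\cdots x_{i_m}$. For $m$ even, $\mathcal{A}$ is a PSD (positive semi-definite) tensor if $\mathcal{A}\mathbf{x}^{\otimes m}\ge 0$ for all $\mathbf{x}\in\mathbb{R}^n$; it is an SOS tensor if the polynomial $\mathbf{x}\mapsto\mathcal{A}\mathbf{x}^{\otimes m}$ is a sum of squares of real polynomials of degree $m/2$. Hankel tensor: $\mathcal{A}\in \mathrm{S}_{m,n}$ is a Hankel tensor with generating vector $\mathbf{v}=(v_0,\dots,v_{(n-1)m})^\top$ if $a_{i_1\cdots i_m}=v_{i_1+\cdots+i_m-m}$ for all $i_1,\dots,i_m\in[n]$. Strong Hankel tensor ($m$ even): a Hankel tensor whose associated Hankel matrix $A=(v_{i+j-2})_{1\le i,j\le \ell}$, $\ell=\frac{(n-1)m}{2}+1$, is positive semi-definite. *)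

theory Defs
  imports "Jordan_Normal_Form.Matrix" "HOL-Library.Poly_Mapping" "HOL-Library.Multiset"
begin

text \<open>
  A tensor of order \<open>m\<close> and dimension \<open>n\<close> is a real function on index lists; only its
  values on lists of length \<open>m\<close> matter. As for the vectors and matrices of
  \<^theory>\<open>Jordan_Normal_Form.Matrix\<close>, indices range over \<open>{0..<n}\<close> rather than
  \<open>{1..n}\<close>, so the shifts \<open>i\<^sub>1 + \<dots> + i\<^sub>m - m\<close> and \<open>i + j - 2\<close> of the
  1-based convention become plain sums of indices.
\<close>

type_synonym tensor = "nat list \<Rightarrow> real"

definition tensor_indices :: "nat \<Rightarrow> nat \<Rightarrow> nat list set" where
  "tensor_indices m n = {ix. set ix \<subseteq> {0..<n} \<and> length ix = m}"

definition symmetric_tensor :: "nat \<Rightarrow> nat \<Rightarrow> tensor \<Rightarrow> bool" where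
  "symmetric_tensor m n A \<longleftrightarrow>
     (\<forall>ix \<in> tensor_indices m n. \<forall>js \<in> tensor_indices m n. mset ix = mset js \<longrightarrow> A ix = A js)"

definition tensor_form :: "nat \<Rightarrow> nat \<Rightarrow> tensor \<Rightarrow> real vec \<Rightarrow> real" where
  "tensor_form m n A x = (\<Sum>ix \<in> tensor_indices m n. A ix * (\<Prod>i\<leftarrow>ix. x $ i))"

definition psd_tensor :: "nat \<Rightarrow> nat \<Rightarrow> tensor \<Rightarrow> bool" where
  "psd_tensor m n A \<longleftrightarrow> symmetric_tensor m n A \<and> (\<forall>x \<in> carrier_vec n. tensor_form m n A x \<ge> 0)"

text \<open>
  Real polynomials in the variables \<open>X\<^sub>0, X\<^sub>1, \<dots>\<close>: finitely supported maps from
  monomials (finitely supported exponent functions) to coefficients.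
\<close>

type_synonym real_mpoly = "(nat \<Rightarrow>\<^sub>0 nat) \<Rightarrow>\<^sub>0 real"

definition mpoly_vars :: "real_mpoly \<Rightarrow> nat set" where
  "mpoly_vars p = (\<Union>e \<in> Poly_Mapping.keys p. Poly_Mapping.keys e)"

definition mpoly_degree :: "real_mpoly \<Rightarrow> nat" where
  "mpoly_degree p =
     Max (insert 0 ((\<lambda>e. \<Sum>i \<in> Poly_Mapping.keys e. Poly_Mapping.lookup e i) ` Poly_Mapping.keys p))"

definition mpoly_eval :: "real_mpoly \<Rightarrow> real vec \<Rightarrow> real" where
  "mpoly_eval p x =
     (\<Sum>e \<in> Poly_Mapping.keys p. Poly_Mapping.lookup p e *
        (\<Prod>i \<in> Poly_Mapping.keys e. (x $ i) ^ Poly_Mapping.lookup e i))"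

text \<open>
  Equality of the polynomials is stated as equality of the polynomial functions on
  \<open>\<real>\<^sup>n\<close>, which is the same thing over the infinite field \<open>\<real>\<close>. The list may be
  empty, so that the zero tensor is a sum of squares although the zero polynomial does
  not have degree \<open>m div 2\<close> for \<open>m \<ge> 2\<close>.
\<close>

definition sos_tensor :: "nat \<Rightarrow> nat \<Rightarrow> tensor \<Rightarrow> bool" where
  "sos_tensor m n A \<longleftrightarrow> symmetric_tensor m n A \<and>
     (\<exists>ps :: real_mpoly list.
        (\<forall>p \<in> set ps. mpoly_vars p \<subseteq> {0..<n} \<and> mpoly_degree p = m div 2) \<and>
        (\<forall>x \<in> carrier_vec n. tensor_form m n A x = (\<Sum>p\<leftarrow>ps. (mpoly_eval p x)\<^sup>2)))"

definition hankel_tensor :: "nat \<Rightarrow> nat \<Rightarrow> tensor \<Rightarrow> real vec \<Rightarrow> bool" where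
  "hankel_tensor m n A v \<longleftrightarrow> symmetric_tensor m n A \<and> v \<in> carrier_vec ((n - 1) * m + 1) \<and>
     (\<forall>ix \<in> tensor_indices m n. A ix = v $ sum_list ix)"

definition hankel_matrix :: "nat \<Rightarrow> nat \<Rightarrow> real vec \<Rightarrow> real mat" where
  "hankel_matrix m n v =
     (let l = (n - 1) * m div 2 + 1 in mat l l (\<lambda>(i, j). v $ (i + j)))"

definition psd_matrix :: "real mat \<Rightarrow> bool" where
  "psd_matrix M \<longleftrightarrow> square_mat M \<and> transpose_mat M = M \<and>
     (\<forall>u \<in> carrier_vec (dim_row M). u \<bullet> (M *\<^sub>v u) \<ge> 0)"

definition strong_hankel_tensor :: "nat \<Rightarrow> nat \<Rightarrow> tensor \<Rightarrow> bool" where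
  "strong_hankel_tensor m n A \<longleftrightarrow>
     (\<exists>v. hankel_tensor m n A v \<and> psd_matrix (hankel_matrix m n v))"

end

theory Submission
  imports Defs
begin

text \<open>
  Put \<open>k = m div 2\<close> and \<open>l = (n - 1) * k + 1\<close>. An index list of length \<open>m\<close> splits uniquely
  as \<open>a @ b\<close> with \<open>a\<close>, \<open>b\<close> of length \<open>k\<close>, and the Hankel property turns the coefficient at
  \<open>a @ b\<close> into \<open>v (sum_list a + sum_list b)\<close>. Both sums are less than \<open>l\<close>, so this
  coefficient is an entry of the associated Hankel matrix. A positive semi-definite matrix
  is a finite sum of rank-one matrices \<open>w i * w j\<close> (lemma \<open>psd_kernel_is_gram\<close>), and with
  such a decomposition the form becomes

  \<open>\<Sum>a. \<Sum>b. \<Sum>w. w (\<sigma> a) * w (\<sigma> b) * x\<^sup>a * x\<^sup>b = \<Sum>w. (\<Sum>a. w (\<sigma> a) * x\<^sup>a)\<^sup>2\<close>,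

  where \<open>\<sigma>\<close> is the sum of an index list and \<open>x\<^sup>a\<close> the product of the \<open>x i\<close> over the entries
  \<open>i\<close> of \<open>a\<close>. The squared polynomials are homogeneous of degree \<open>k\<close>. Those that vanish
  identically do not have degree \<open>k\<close>, but they can be left out of the sum. Positive
  semi-definiteness of the tensor follows at once from the sum of squares.
\<close>

section \<open>Gram decompositions of positive semi-definite kernels\<close>

lemma quadratic_form_insert:
  fixes M :: "'a \<Rightarrow> 'a \<Rightarrow> real"
  assumes "finite S" and "a \<notin> S" and sym: "\<And>i. i \<in> S \<Longrightarrow> M i a = M a i"
  shows "(\<Sum>i\<in>insert a S. \<Sum>j\<in>insert a S. M i j * u i * u j) =
         M a a * (u a)\<^sup>2 + 2 * u a * (\<Sum>i\<in>S. M a i * u i) + (\<Sum>i\<in>S. \<Sum>j\<in>S. M i j * u i * u j)"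
proof -
  have col: "(\<Sum>i\<in>S. M i a * u i * u a) = u a * (\<Sum>i\<in>S. M a i * u i)"
    unfolding sum_distrib_left by (rule sum.cong) (simp_all add: sym)
  have row: "(\<Sum>j\<in>S. M a j * u a * u j) = u a * (\<Sum>i\<in>S. M a i * u i)"
    unfolding sum_distrib_left by (rule sum.cong) simp_all
  show ?thesis
    using assms(1,2) by (simp add: sum.distrib col row power2_eq_square)
qed

lemma psd_zero_diagonal_imp_zero_row:
  fixes M :: "'a \<Rightarrow> 'a \<Rightarrow> real"
  assumes "finite S" and "a \<notin> S" and sym: "\<And>i. i \<in> S \<Longrightarrow> M i a = M a i"
    and psd: "\<And>u. 0 \<le> (\<Sum>i\<in>insert a S. \<Sum>j\<in>insert a S. M i j * u i * u j)"
    and zero: "M a a = 0" and "j \<in> S"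
  shows "M a j = 0"
proof (rule ccontr)
  assume nz: "M a j \<noteq> 0"
  \<comment> \<open>On vectors with coordinate \<open>1\<close> at \<open>j\<close> and \<open>t\<close> at \<open>a\<close>, zero elsewhere, the form is
    affine in \<open>t\<close> with nonzero slope; this \<open>t\<close> makes it equal to \<open>-1\<close>.\<close>
  define t where "t = - (M j j + 1) / (2 * M a j)"
  define u where "u i = (if i = a then t else if i = j then 1 else 0)" for i
  have "j \<noteq> a" using assms by auto
  have uS: "u i = (if i = j then 1 else 0)" if "i \<in> S" for i
    using that assms(2) by (auto simp: u_def)
  have lin: "(\<Sum>i\<in>S. M a i * u i) = M a j"
    using assms(1,6) by (simp add: uS if_distrib cong: if_cong sum.cong)
  have "(\<Sum>i\<in>S. \<Sum>i'\<in>S. M i i' * u i * u i') = (\<Sum>i\<in>S. if i = j then M j j else 0)"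
    using assms(1,6) by (intro sum.cong) (auto simp: uS if_distrib cong: if_cong sum.cong)
  hence quad: "(\<Sum>i\<in>S. \<Sum>i'\<in>S. M i i' * u i * u i') = M j j"
    using assms(1,6) by simp
  have "0 \<le> 2 * t * M a j + M j j"
    using psd[of u] quadratic_form_insert[OF assms(1,2), of M u, OF sym]
    by (simp add: zero lin quad) (simp add: u_def)
  moreover have "2 * t * M a j + M j j = -1"
    using nz by (simp add: t_def) (simp add: field_simps)
  ultimately show False by simp
qed

text \<open>
  This is Gaussian elimination: subtracting the rank-one kernel given by row \<open>a\<close> kills that
  row, and minimising the form over the coordinate at \<open>a\<close> shows that the remaining Schur
  complement is still positive semi-definite. Since division by zero gives zero, the same
  formulas also cover a vanishing pivot, where positivity forces the whole row to vanish.
\<close>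
lemma psd_kernel_is_gram:
  fixes M :: "'a \<Rightarrow> 'a \<Rightarrow> real"
  assumes "finite S"
    and "\<And>i j. i \<in> S \<Longrightarrow> j \<in> S \<Longrightarrow> M i j = M j i"
    and "\<And>u. 0 \<le> (\<Sum>i\<in>S. \<Sum>j\<in>S. M i j * u i * u j)"
  shows "\<exists>ws. \<forall>i\<in>S. \<forall>j\<in>S. M i j = (\<Sum>w\<leftarrow>ws. w i * w j)"
  using assms
proof (induction S arbitrary: M rule: finite_induct)
  case empty
  show ?case by simp
next
  case (insert a S)
  note sym = insert.prems(1) and psd = insert.prems(2)
  have symS: "M i a = M a i" if "i \<in> S" for i
    using sym that by blast
  note form = quadratic_form_insert[OF insert.hyps, of M, OF symS]
  define M' where "M' i j = M i j - M a i * M a j / M a a" for i j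
  define \<delta> :: "'a \<Rightarrow> real" where "\<delta> i = (if i = a then 1 else 0)" for i
  have "\<delta> a = 1" and "\<And>i. i \<in> S \<Longrightarrow> \<delta> i = 0"
    using insert.hyps by (auto simp: \<delta>_def)
  hence diag: "0 \<le> M a a"
    using psd[of \<delta>] form[of \<delta>] by simp
  have row: "M' a j = 0" if "j \<in> insert a S" for j
    using psd_zero_diagonal_imp_zero_row[OF insert.hyps, of M j, OF symS psd] that
    by (cases "M a a = 0") (auto simp: M'_def)
  have "0 \<le> (\<Sum>i\<in>S. \<Sum>j\<in>S. M' i j * u i * u j)" for u
  proof -
    define L where "L = (\<Sum>i\<in>S. M a i * u i)"
    \<comment> \<open>The coordinate at \<open>a\<close> that minimises the form when the others are given by \<open>u\<close>.\<close>
    define u' where "u' = u(a := - L / M a a)"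
    have same: "u' i = u i" if "i \<in> S" for i
      using that insert.hyps by (auto simp: u'_def)
    have "0 \<le> M a a * (L / M a a)\<^sup>2 - 2 * (L / M a a) * L
              + (\<Sum>i\<in>S. \<Sum>j\<in>S. M i j * u i * u j)"
      using psd[of u'] form[of u'] by (simp add: same L_def cong: sum.cong) (simp add: u'_def L_def)
    also have "M a a * (L / M a a)\<^sup>2 - 2 * (L / M a a) * L = - (L * L / M a a)"
      by (cases "M a a = 0") (simp_all add: power2_eq_square)
    also have "L * L / M a a = (\<Sum>i\<in>S. \<Sum>j\<in>S. M a i * M a j / M a a * u i * u j)"
      unfolding L_def sum_product sum_divide_distrib by (simp add: mult_ac)
    finally show ?thesis
      by (simp add: M'_def algebra_simps sum_subtractf)
  qed
  moreover have "M' i j = M' j i" if "i \<in> S" "j \<in> S" for i j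
    using sym that by (simp add: M'_def mult.commute)
  ultimately obtain ws where ws: "\<And>i j. i \<in> S \<Longrightarrow> j \<in> S \<Longrightarrow> M' i j = (\<Sum>w\<leftarrow>ws. w i * w j)"
    using insert.IH[of M'] by blast
  define pivot where "pivot i = M a i / sqrt (M a a)" for i
  \<comment> \<open>The vectors for \<open>S\<close> are arbitrary at \<open>a\<close>, where they must contribute nothing.\<close>
  define ws' where "ws' = map (\<lambda>w i. if i \<in> S then w i else 0) ws"
  have pivot: "pivot i * pivot j = M a i * M a j / M a a" for i j
    using diag by (simp add: pivot_def)
  have rest: "M' i j = (\<Sum>w\<leftarrow>ws'. w i * w j)" if "i \<in> insert a S" "j \<in> insert a S" for i j
  proof (cases "i = a \<or> j = a")
    case True
    have "M' i j = M' j i" using sym that by (simp add: M'_def mult.commute)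
    hence "M' i j = 0" using True row that by auto
    moreover have "(\<Sum>w\<leftarrow>ws'. w i * w j) = 0"
      using True insert.hyps by (auto simp: ws'_def o_def)
    ultimately show ?thesis by simp
  next
    case False
    thus ?thesis using that ws by (simp add: ws'_def o_def)
  qed
  have "M i j = (\<Sum>w\<leftarrow>pivot # ws'. w i * w j)" if "i \<in> insert a S" "j \<in> insert a S" for i j
    using rest[OF that] by (simp add: pivot M'_def)
  thus ?case by blast
qed

section \<open>Polynomials indexed by lists of variables\<close>

definition list_monomial :: "nat list \<Rightarrow> (nat \<Rightarrow>\<^sub>0 nat)" where
  "list_monomial a = (\<Sum>i\<leftarrow>a. Poly_Mapping.single i 1)"

definition list_poly :: "nat list set \<Rightarrow> (nat list \<Rightarrow> real) \<Rightarrow> real_mpoly" where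
  "list_poly I c = (\<Sum>a\<in>I. Poly_Mapping.single (list_monomial a) (c a))"

lemma lookup_list_monomial: "Poly_Mapping.lookup (list_monomial a) i = count (mset a) i"
  by (induction a) (auto simp: list_monomial_def lookup_add lookup_single when_def)

lemma keys_list_monomial: "Poly_Mapping.keys (list_monomial a) = set a"
  by (auto simp: in_keys_iff lookup_list_monomial count_eq_zero_iff)

lemma list_monomial_value:
  "(\<Prod>i\<in>Poly_Mapping.keys (list_monomial a). x i ^ Poly_Mapping.lookup (list_monomial a) i)
   = (\<Prod>i\<leftarrow>a. x i :: real)"
proof -
  have "(\<Prod>i\<leftarrow>a. x i) = prod_mset (image_mset x (mset a))"
    by (simp add: prod_mset_prod_list flip: mset_map)
  also have "\<dots> = (\<Prod>i\<in>set a. x i ^ count (mset a) i)"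
    by (simp add: image_prod_mset_multiplicity)
  finally show ?thesis
    by (simp add: keys_list_monomial lookup_list_monomial)
qed

lemma list_monomial_degree:
  "(\<Sum>i\<in>Poly_Mapping.keys (list_monomial a). Poly_Mapping.lookup (list_monomial a) i) = length a"
  using size_multiset_overloaded_eq[of "mset a"]
  by (simp add: keys_list_monomial lookup_list_monomial)

lemma mpoly_eval_superset:
  assumes "finite K" and "Poly_Mapping.keys p \<subseteq> K"
  shows "mpoly_eval p x = (\<Sum>e\<in>K. Poly_Mapping.lookup p e *
           (\<Prod>i\<in>Poly_Mapping.keys e. (x $ i) ^ Poly_Mapping.lookup e i))"
  unfolding mpoly_eval_def using assms
  by (intro sum.mono_neutral_left) (auto simp: in_keys_iff)

lemma mpoly_eval_add: "mpoly_eval (p + q) x = mpoly_eval p x + mpoly_eval q x"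
proof -
  let ?K = "Poly_Mapping.keys p \<union> Poly_Mapping.keys q"
  have fin: "finite ?K" by simp
  show ?thesis
    using mpoly_eval_superset[OF fin, of p x] mpoly_eval_superset[OF fin, of q x]
      mpoly_eval_superset[OF fin Poly_Mapping.keys_add, of x]
    by (simp add: lookup_add distrib_right sum.distrib)
qed

lemma mpoly_eval_list_poly:
  assumes "finite I"
  shows "mpoly_eval (list_poly I c) x = (\<Sum>a\<in>I. c a * (\<Prod>i\<leftarrow>a. x $ i))"
proof -
  have single: "mpoly_eval (Poly_Mapping.single (list_monomial a) r) x = r * (\<Prod>i\<leftarrow>a. x $ i)"
    for a r
    using mpoly_eval_superset[of "{list_monomial a}" "Poly_Mapping.single (list_monomial a) r" x]
    by (simp add: list_monomial_value)
  have zero: "mpoly_eval 0 x = 0"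
    by (simp add: mpoly_eval_def)
  show ?thesis
    unfolding list_poly_def using assms
    by (induction I rule: finite_induct) (simp_all add: zero mpoly_eval_add single)
qed

lemma keys_list_poly: "Poly_Mapping.keys (list_poly I c) \<subseteq> list_monomial ` I"
proof -
  have "Poly_Mapping.keys (list_poly I c) \<subseteq>
        (\<Union>a\<in>I. Poly_Mapping.keys (Poly_Mapping.single (list_monomial a) (c a)))"
    unfolding list_poly_def by (rule Poly_Mapping.keys_sum)
  also have "\<dots> \<subseteq> list_monomial ` I"
    by (auto split: if_splits)
  finally show ?thesis .
qed

lemma mpoly_vars_list_poly: "mpoly_vars (list_poly (tensor_indices k n) c) \<subseteq> {0..<n}"
  using keys_list_poly[of "tensor_indices k n" c]
  by (fastforce simp: mpoly_vars_def tensor_indices_def keys_list_monomial)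

lemma mpoly_degree_list_poly:
  assumes "list_poly (tensor_indices k n) c \<noteq> 0"
  shows "mpoly_degree (list_poly (tensor_indices k n) c) = k"
proof -
  let ?p = "list_poly (tensor_indices k n) c"
  have "(\<Sum>i\<in>Poly_Mapping.keys e. Poly_Mapping.lookup e i) = k"
    if key: "e \<in> Poly_Mapping.keys ?p" for e
  proof -
    obtain a where "a \<in> tensor_indices k n" "e = list_monomial a"
      using key keys_list_poly[of "tensor_indices k n" c] by blast
    thus ?thesis by (simp add: list_monomial_degree tensor_indices_def)
  qed
  moreover have "Poly_Mapping.keys ?p \<noteq> {}"
    using assms by simp
  ultimately have "(\<lambda>e. \<Sum>i\<in>Poly_Mapping.keys e. Poly_Mapping.lookup e i) ` Poly_Mapping.keys ?p = {k}"
    by (simp add: image_constant_conv cong: image_cong)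
  thus ?thesis by (simp add: mpoly_degree_def)
qed

section \<open>Tensors of even order\<close>

lemma finite_tensor_indices: "finite (tensor_indices m n)"
  unfolding tensor_indices_def by (rule finite_lists_length_eq) simp

lemma bij_betw_append_tensor_indices:
  "bij_betw (\<lambda>(a, b). a @ b) (tensor_indices k n \<times> tensor_indices l n) (tensor_indices (k + l) n)"
proof (rule bij_betw_byWitness[where f' = "\<lambda>ix. (take k ix, drop k ix)"])
  show "(\<lambda>ix. (take k ix, drop k ix)) ` tensor_indices (k + l) n
        \<subseteq> tensor_indices k n \<times> tensor_indices l n"
    by (auto simp: tensor_indices_def dest!: in_set_takeD in_set_dropD)
qed (fastforce simp: tensor_indices_def)+

text \<open>
  A tensor of order \<open>2 k\<close> is a square matrix whose rows and columns are indexed by lists of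
  length \<open>k\<close>. If this flattening is a Gram matrix, expanding the squares of the linear
  combinations of monomials recovers the form. Zero polynomials are dropped because they
  fail the degree requirement when \<open>k > 0\<close>.
\<close>
lemma gram_flattening_imp_sos_tensor:
  assumes sym: "symmetric_tensor (k + k) n A"
    and gram: "\<And>a b. a \<in> tensor_indices k n \<Longrightarrow> b \<in> tensor_indices k n \<Longrightarrow>
                 A (a @ b) = (\<Sum>c\<leftarrow>cs. c a * c b)"
  shows "sos_tensor (k + k) n A"
proof -
  let ?I = "tensor_indices k n"
  define ps where "ps = filter (\<lambda>p. p \<noteq> 0) (map (list_poly ?I) cs)"
  have "tensor_form (k + k) n A x = (\<Sum>p\<leftarrow>ps. (mpoly_eval p x)\<^sup>2)" for x
  proof -
    define \<mu> where "\<mu> a = (\<Prod>i\<leftarrow>a. x $ i)" for a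
    have "tensor_form (k + k) n A x = (\<Sum>(a, b)\<in>?I \<times> ?I. A (a @ b) * \<mu> (a @ b))"
      unfolding tensor_form_def \<mu>_def
      using sum.reindex_bij_betw[OF bij_betw_append_tensor_indices[of k n k],
          of "\<lambda>ix. A ix * (\<Prod>i\<leftarrow>ix. x $ i)"]
      by (simp add: case_prod_unfold)
    also have "\<dots> = (\<Sum>a\<in>?I. \<Sum>b\<in>?I. A (a @ b) * \<mu> (a @ b))"
      by (simp add: sum.cartesian_product)
    also have "\<dots> = (\<Sum>a\<in>?I. \<Sum>b\<in>?I. \<Sum>c\<leftarrow>cs. (c a * \<mu> a) * (c b * \<mu> b))"
      by (intro sum.cong refl) (simp add: gram \<mu>_def mult_ac flip: sum_list_const_mult)
    also have "\<dots> = (\<Sum>c\<leftarrow>cs. \<Sum>a\<in>?I. \<Sum>b\<in>?I. (c a * \<mu> a) * (c b * \<mu> b))"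
      by (induction cs) (simp_all add: sum.distrib)
    also have "\<dots> = (\<Sum>c\<leftarrow>cs. (mpoly_eval (list_poly ?I c) x)\<^sup>2)"
      by (simp add: mpoly_eval_list_poly[OF finite_tensor_indices] \<mu>_def power2_eq_square sum_product)
    also have "\<dots> = (\<Sum>p\<leftarrow>ps. (mpoly_eval p x)\<^sup>2)"
      unfolding ps_def by (induction cs) (auto simp: mpoly_eval_def)
    finally show ?thesis .
  qed
  moreover have "mpoly_vars p \<subseteq> {0..<n} \<and> mpoly_degree p = (k + k) div 2" if "p \<in> set ps" for p
    using that mpoly_vars_list_poly mpoly_degree_list_poly by (auto simp: ps_def)
  ultimately show ?thesis
    unfolding sos_tensor_def using sym by blast
qed

lemma sos_tensor_imp_psd_tensor:
  assumes "sos_tensor m n A"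
  shows "psd_tensor m n A"
  using assms unfolding sos_tensor_def psd_tensor_def
  by (auto intro!: sum_list_nonneg)

section \<open>Strong Hankel tensors\<close>

lemma sum_list_tensor_index_bound:
  assumes "a \<in> tensor_indices k n"
  shows "sum_list a \<le> (n - 1) * k"
proof -
  have "set a \<subseteq> {0..<n} \<Longrightarrow> sum_list a \<le> (n - 1) * length a"
    by (induction a) auto
  thus ?thesis using assms by (simp add: tensor_indices_def)
qed

lemma psd_matrix_quadratic_form:
  assumes "psd_matrix (mat l l (\<lambda>(i, j). f i j))"
  shows "0 \<le> (\<Sum>i<l. \<Sum>j<l. f i j * u i * u j)"
proof -
  let ?M = "mat l l (\<lambda>(i, j). f i j)"
  have "0 \<le> vec l u \<bullet> (?M *\<^sub>v vec l u)"
    using assms unfolding psd_matrix_def by simp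
  also have "\<dots> = (\<Sum>i<l. \<Sum>j<l. f i j * u i * u j)"
    by (auto simp: scalar_prod_def sum_distrib_left lessThan_atLeast0 mult_ac intro!: sum.cong)
  finally show ?thesis .
qed

theorem corollary2:
  fixes m n :: nat and A :: tensor
  assumes "n \<ge> 2" and "m \<ge> 2" and "even m"
    and "strong_hankel_tensor m n A"
  shows "sos_tensor m n A \<and> psd_tensor m n A"
proof -
  obtain k where m: "m = k + k"
    using \<open>even m\<close> by (metis evenE mult_2)
  define l where "l = (n - 1) * k + 1"
  obtain v where hankel: "hankel_tensor m n A v" and psd: "psd_matrix (hankel_matrix m n v)"
    using assms(4) unfolding strong_hankel_tensor_def by blast
  have "(n - 1) * m div 2 + 1 = l"
    by (simp add: m l_def flip: distrib_left mult_2)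
  hence "psd_matrix (mat l l (\<lambda>(i, j). v $ (i + j)))"
    using psd by (simp add: hankel_matrix_def)
  note quad = psd_matrix_quadratic_form[OF this]
  obtain ws where ws: "\<forall>i\<in>{..<l}. \<forall>j\<in>{..<l}. v $ (i + j) = (\<Sum>w\<leftarrow>ws. w i * w j)"
    using psd_kernel_is_gram[of "{..<l}" "\<lambda>i j. v $ (i + j)"] quad
    by (auto simp: add.commute)
  have "A (a @ b) = (\<Sum>c\<leftarrow>map (\<lambda>w a. w (sum_list a)) ws. c a * c b)"
    if a: "a \<in> tensor_indices k n" and b: "b \<in> tensor_indices k n" for a b
  proof -
    have "a @ b \<in> tensor_indices m n"
      using a b by (simp add: tensor_indices_def m)
    hence "A (a @ b) = v $ (sum_list a + sum_list b)"
      using hankel by (simp add: hankel_tensor_def)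
    moreover have "sum_list a < l" "sum_list b < l"
      using sum_list_tensor_index_bound a b by (fastforce simp: l_def)+
    ultimately show ?thesis
      using ws by (simp add: o_def)
  qed
  moreover have "symmetric_tensor (k + k) n A"
    using hankel by (simp add: hankel_tensor_def m)
  ultimately have "sos_tensor m n A"
    unfolding m by (intro gram_flattening_imp_sos_tensor)
  thus ?thesis
    using sos_tensor_imp_psd_tensor by blast
qed

end
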